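(* Let $\mathcal{G}=(\mathcal{V},\mathcal{E})$ be an undirected graph on $N$ nodes with adjacency matrix $\mathbf{A}\in\{0,1\}^{N\times N}$, diagonal degree matrix $\mathbf{D}$ with all degrees positive, and normalized Laplacian $\mathbf{L}=\mathbf{I}_N-\mathbf{D}^{-1/2}\mathbf{A}\mathbf{D}^{-1/2}$. Let $\mathbf{L}=\mathbf{V}\boldsymbol{\Lambda}\mathbf{V}^{\top}$ be an eigendecomposition with $\mathbf{V}\in\mathbb{R}^{N\times N}$ orthogonal and $\boldsymbol{\Lambda}=\operatorname{diag}(\lambda_1,\ldots,\lambda_N)$. Let $\mathbf{s}\in\{-1,1\}^N$ and $\tilde{\mathbf{s}}=\mathbf{V}^{\top}\mathbf{s}$. Define $m_i:=|\tilde s_i|\,|1-\lambda_i|$ for $i=1,\ldots,N$ and $m_{\max}:=\max_i m_i$. Let $\tau\in\mathbb{R}$, $\mathcal{C}:=\{i : m_i>\tau\, m_{\max}\}$, $k:=|\mathcal{C}|$, and assume $k<N$. Define the fair filter $\tilde{\mathbf{h}}^{\mathrm{fair}}\in\mathbb{R}^N$ by $$\tilde h_i^{\mathrm{fair}}=\begin{cases}\dfrac{\frac{1}{N-k}\sum_{1\le j\le N,\, j\notin\mathcal{C}} m_j}{m_i}, & i\in\mathcal{C},\\[2mm] 1, & i\notin\mathcal{C},\end{cases}$$ and the uniform fairness-agnostic filter $\tilde{\mathbf{h}}^{u}\in\mathbb{R}^N$ by $\tilde h^{u}_j=\frac{1}{N}\sum_{i=1}^{N}\tilde h_i^{\mathrm{fair}}$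 for all $j=1,\ldots,N$. Then $$\sum_{i=1}^{N}|\tilde s_i|\,|1-\lambda_i|\,|\tilde h_i^{\mathrm{fair}}|\;\le\;\sum_{i=1}^{N}|\tilde s_i|\,|1-\lambda_i|\,|\tilde h_i^{u}|.$$
   Context: The adjacency matrix satisfies $A_{ij}=1$ if and only if $(v_i,v_j)\in\mathcal{E}$ (so $\mathbf{A}$ is symmetric), and $D_{ii}$ is the degree of node $v_i$. The vector $\mathbf{s}$ is the binary sensitive attribute of the nodes and $\tilde{\mathbf{s}}$ its graph Fourier transform. The real number $\tau$ is a threshold hyperparameter. For a filter with frequency response $\tilde{\mathbf{h}}$, the quantity $\sqrt{N}\sum_{i=1}^N|\tilde s_i||1-\lambda_i||\tilde h_i|$ is an upper bound on the correlation measure $\rho=\|\mathbf{s}^{\top}\mathbf{A}^f\|_1$, where $\mathbf{A}^f=\mathbf{V}(\mathbf{I}_N-\boldsymbol{\Lambda})\operatorname{diag}(\tilde{\mathbf{h}})\mathbf{V}^{\top}$; the claim compares this bound (up to the common factor $\sqrt N$) for the two filters. *)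

theory Defs
  imports "HOL-Analysis.Analysis"
begin

text \<open>
  An undirected graph on \<open>N = CARD('n)\<close> nodes is a symmetric edge relation on the finite type \<open>'n\<close>;
  the same type indexes the eigenvalues. Self-loops are not excluded; a loop contributes 1 to the
  degree, so that the degree is always the row sum of the adjacency matrix.
\<close>

definition adjacency_matrix :: "('n \<times> 'n) set \<Rightarrow> real^'n^'n" where
  "adjacency_matrix E = (\<chi> i j. if (i, j) \<in> E then 1 else 0)"

definition node_degree :: "('n \<times> 'n) set \<Rightarrow> 'n \<Rightarrow> nat" where
  "node_degree E i = card {j. (i, j) \<in> E}"

definition diag_matrix :: "real^'n \<Rightarrow> real^'n^'n" where
  "diag_matrix d = (\<chi> i j. if i = j then d $ i else 0)"

text \<open>The diagonal matrix \<open>D\<^sup>p\<close>, meaningful for negative \<open>p\<close> only when all degrees are positive.\<close>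

definition degree_matrix_powr :: "('n \<times> 'n) set \<Rightarrow> real \<Rightarrow> real^'n^'n" where
  "degree_matrix_powr E p = diag_matrix (\<chi> i. real (node_degree E i) powr p)"

definition normalized_laplacian :: "('n::finite \<times> 'n) set \<Rightarrow> real^'n^'n" where
  "normalized_laplacian E =
     mat 1 - degree_matrix_powr E (- 1 / 2) ** adjacency_matrix E ** degree_matrix_powr E (- 1 / 2)"

definition graph_fourier :: "real^'n^'n \<Rightarrow> real^'n \<Rightarrow> real^'n" where
  "graph_fourier V s = transpose V *v s"

text \<open>Below, \<open>st\<close> is the graph Fourier transform of the sensitive attribute and \<open>l\<close> the vector of
  eigenvalues of the normalized Laplacian.\<close>

definition magnitude :: "real^'n \<Rightarrow> real^'n \<Rightarrow> 'n \<Rightarrow> real" where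
  "magnitude st l i = \<bar>st $ i\<bar> * \<bar>1 - l $ i\<bar>"

definition max_magnitude :: "real^'n::finite \<Rightarrow> real^'n \<Rightarrow> real" where
  "max_magnitude st l = Max (range (magnitude st l))"

definition critical_set :: "real \<Rightarrow> real^'n::finite \<Rightarrow> real^'n \<Rightarrow> 'n set" where
  "critical_set \<tau> st l = {i. magnitude st l i > \<tau> * max_magnitude st l}"

definition fair_filter :: "real \<Rightarrow> real^'n::finite \<Rightarrow> real^'n \<Rightarrow> real^'n" where
  "fair_filter \<tau> st l =
     (let C = critical_set \<tau> st l in
      \<chi> i. if i \<in> C
          then (1 / (real CARD('n) - real (card C)) * (\<Sum>j\<in>- C. magnitude st l j)) / magnitude st l i
          else 1)"

definition uniform_filter :: "real \<Rightarrow> real^'n::finite \<Rightarrow> real^'n \<Rightarrow> real^'n" where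
  "uniform_filter \<tau> st l = (\<chi> j. 1 / real CARD('n) * (\<Sum>i\<in>UNIV. fair_filter \<tau> st l $ i))"

end

theory Submission
  imports Defs
begin

text \<open>
  Write \<open>m\<close> for the magnitudes, \<open>h\<close> for the fair filter, and \<open>a\<close> for the mean of \<open>m\<close> outside the
  critical set \<open>C\<close>. Averaging \<open>m\<close> outside \<open>C\<close> gives weights \<open>w\<close> with the same sum as \<open>m\<close> and with
  \<open>w i * h i = a\<close> for every \<open>i\<close>. Hence the fair bound equals \<open>N * a\<close>, and the Cauchy--Schwarz
  inequality gives \<open>N\<^sup>2 * a \<le> (\<Sum>i. w i) * (\<Sum>i. h i)\<close>, which is \<open>N\<close> times the uniform bound.
\<close>

text \<open>Cauchy-Schwarz for the square roots of \<open>w\<close> and \<open>h\<close>: every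
  product \<open>sqrt (w i) * sqrt (h i)\<close> is \<open>sqrt a\<close>.\<close>

lemma card_sq_times_le_sum_times_sum:
  fixes w h :: "'a \<Rightarrow> real"
  assumes "\<And>i. i \<in> A \<Longrightarrow> 0 \<le> w i" "\<And>i. i \<in> A \<Longrightarrow> 0 \<le> h i" "\<And>i. i \<in> A \<Longrightarrow> w i * h i = a"
    and "0 \<le> a"
  shows "(real (card A))\<^sup>2 * a \<le> (\<Sum>i\<in>A. w i) * (\<Sum>i\<in>A. h i)"
proof -
  have "(\<Sum>i\<in>A. sqrt (w i) * sqrt (h i)) = real (card A) * sqrt a"
    using assms(3) by (simp flip: real_sqrt_mult)
  moreover have "(\<Sum>i\<in>A. (sqrt (w i))\<^sup>2) = (\<Sum>i\<in>A. w i)" "(\<Sum>i\<in>A. (sqrt (h i))\<^sup>2) = (\<Sum>i\<in>A. h i)"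
    using assms(1,2) by simp_all
  ultimately show ?thesis
    using Cauchy_Schwarz_ineq_sum[of "\<lambda>i. sqrt (w i)" "\<lambda>i. sqrt (h i)" A] \<open>0 \<le> a\<close>
    by (simp add: power_mult_distrib)
qed

lemma magnitude_nonneg: "0 \<le> magnitude st l i"
  by (simp add: magnitude_def)

text \<open>Any index outside the critical set forces the threshold \<open>\<tau> * max_magnitude st l\<close> to be
  nonnegative, even if \<open>\<tau>\<close> is negative; so the fair filter never divides by zero.\<close>

lemma magnitude_pos_if_critical:
  assumes "card (critical_set \<tau> st (l :: real^'n::finite)) < CARD('n)"
    and "i \<in> critical_set \<tau> st l"
  shows "0 < magnitude st l i"
proof -
  have "critical_set \<tau> st l \<noteq> UNIV"
    using assms(1) by auto
  then obtain j where "j \<notin> critical_set \<tau> st l"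
    by blast
  then show ?thesis
    using assms(2) magnitude_nonneg[of st l j] by (simp add: critical_set_def)
qed

theorem proposition2:
  fixes E :: "('n::finite \<times> 'n) set"
    and V :: "real^'n^'n" and l s st :: "real^'n" and \<tau> :: real
  assumes undirected: "sym E"
    and degree_pos: "\<And>i. node_degree E i > 0"
    and orthogonal: "orthogonal_matrix V"
    and eigendecomposition: "normalized_laplacian E = V ** diag_matrix l ** transpose V"
    and sensitive: "\<And>i. s $ i \<in> {-1, 1}"
    and fourier: "st = graph_fourier V s"
    and k_less: "card (critical_set \<tau> st l) < CARD('n)"
  shows "(\<Sum>i\<in>UNIV. \<bar>st $ i\<bar> * \<bar>1 - l $ i\<bar> * \<bar>fair_filter \<tau> st l $ i\<bar>)
       \<le> (\<Sum>i\<in>UNIV. \<bar>st $ i\<bar> * \<bar>1 - l $ i\<bar> * \<bar>uniform_filter \<tau> st l $ i\<bar>)"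
proof -
  define m where "m = magnitude st l"
  define C where "C = critical_set \<tau> st l"
  define N where "N = real CARD('n)"
  define a where "a = 1 / (N - real (card C)) * (\<Sum>j\<in>- C. m j)"
  define h where "h i = fair_filter \<tau> st l $ i" for i
  define w where "w i = (if i \<in> C then m i else a)" for i
  have m_nonneg: "0 \<le> m i" for i
    by (simp add: m_def magnitude_nonneg)
  have m_pos: "0 < m i" if "i \<in> C" for i
    using magnitude_pos_if_critical[OF k_less] that by (simp add: m_def C_def)
  have less: "real (card C) < N" and N_pos: "0 < N"
    using k_less by (simp_all add: C_def N_def)
  have h_eq: "h i = (if i \<in> C then a / m i else 1)" for i
    by (simp add: h_def fair_filter_def a_def m_def C_def N_def Let_def)
  have a_nonneg: "0 \<le> a"
    unfolding a_def using less m_nonneg by (intro mult_nonneg_nonneg sum_nonneg) auto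
  have h_nonneg: "0 \<le> h i" and w_nonneg: "0 \<le> w i" and wh: "w i * h i = a" for i
    using a_nonneg m_nonneg[of i] m_pos[of i] by (auto simp: h_eq w_def)
  have card_Compl: "real (card (- C)) = N - real (card C)"
    by (simp add: N_def Compl_eq_Diff_UNIV card_Diff_subset of_nat_diff card_mono)
  have sum_Compl: "(\<Sum>i\<in>- C. m i) = (\<Sum>i\<in>- C. a)"
    using less by (simp add: card_Compl) (simp add: a_def)
  have split: "sum f UNIV = sum f C + sum f (- C)" for f :: "'n \<Rightarrow> real"
    using sum.union_disjoint[of C "- C" f] by simp
  \<comment> \<open>On \<open>C\<close> the weights \<open>w\<close> and \<open>m\<close> agree;
    outside \<open>C\<close>, \<open>h\<close> is 1, so only the total of \<open>m\<close> there
    counts, and averaging preserves it.\<close>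
  have "(\<Sum>i\<in>UNIV. m i * h i) = (\<Sum>i\<in>UNIV. w i * h i)"
    using sum_Compl by (simp add: split h_eq w_def)
  then have fair: "(\<Sum>i\<in>UNIV. m i * h i) = N * a"
    by (simp add: wh N_def)
  have sum_m: "(\<Sum>i\<in>UNIV. m i) = (\<Sum>i\<in>UNIV. w i)"
    using sum_Compl by (simp add: split w_def)
  have "N\<^sup>2 * a \<le> (\<Sum>i\<in>UNIV. m i) * (\<Sum>i\<in>UNIV. h i)"
    using card_sq_times_le_sum_times_sum[of UNIV w h a] w_nonneg h_nonneg wh a_nonneg
    by (simp add: sum_m N_def)
  then have "N * a \<le> (\<Sum>i\<in>UNIV. m i) * (1 / N * (\<Sum>i\<in>UNIV. h i))"
    using N_pos by (simp add: field_simps power2_eq_square)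
  \<comment> \<open>The uniform filter is a nonnegative constant, so it factors out of the uniform
    bound.\<close>
  moreover have "\<bar>uniform_filter \<tau> st l $ i\<bar> = 1 / N * (\<Sum>i\<in>UNIV. h i)" for i
    using N_pos h_nonneg by (simp add: uniform_filter_def h_def N_def sum_nonneg)
  ultimately show ?thesis
    using fair h_nonneg by (simp add: m_def magnitude_def h_def sum_distrib_right sum_divide_distrib)
qed

end
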